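(* Let $\theta\in\mathbb{R}$. (i) If $\varepsilon\in E_1$ then $$e^{\varepsilon\theta}=\Big(1+\frac{\theta^2}{2!}+\frac{\theta^4}{4!}+\cdots\Big)+\varepsilon\Big(\theta+\frac{\theta^3}{3!}+\frac{\theta^5}{5!}+\cdots\Big)=\cosh\theta+\varepsilon\sinh\theta.$$ (ii) If $\varepsilon\in E_{-1}$ then $$e^{\varepsilon\theta}=\Big(1-\frac{\theta^2}{2!}+\frac{\theta^4}{4!}-\cdots\Big)+\varepsilon\Big(\theta-\frac{\theta^3}{3!}+\frac{\theta^5}{5!}-\cdots\Big)=\cos\theta+\varepsilon\sin\theta.$$ (iii) If $\varepsilon\in E_0$ then $$e^{\varepsilon\theta}=1+\varepsilon\theta.$$
   Context: $C\ell_2=C\ell_{2,0}$ is the associative unital real algebra with $\mathbb{R}$-basis $\mathbf{e}_0=1,\mathbf{e}_1,\mathbf{e}_2,\mathbf{e}_3$ and multiplication rules $\mathbf{e}_1^2=\mathbf{e}_2^2=1$, $\mathbf{e}_3^2=-1$, $\mathbf{e}_1\mathbf{e}_2=\mathbf{e}_3=-\mathbf{e}_2\mathbf{e}_1$, $\mathbf{e}_2\mathbf{e}_3=-\mathbf{e}_1=-\mathbf{e}_3\mathbf{e}_2$, $\mathbf{e}_3\mathbf{e}_1=-\mathbf{e}_2=-\mathbf{e}_1\mathbf{e}_3$. For $c\in\{1,0,-1\}$, $E_c=\{\epsilon_1\mathbf{e}_1+\epsilon_2\mathbf{e}_2+\epsilon_3\mathbf{e}_3:\epsilon_1,\epsilon_2,\epsilon_3\in\mathbb{R},\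 \epsilon_1^2+\epsilon_2^2-\epsilon_3^2=c\}$. The exponential function on $C\ell_2$ is defined by the power series $e^a=\sum_{k=0}^{\infty}\frac{a^k}{k!}$ for $a\in C\ell_2$ (convergence in the finite-dimensional real vector space $C\ell_2$). *)

theory Defs
  imports Complex_Main
begin

text \<open>\<open>Cl2 a b c d\<close> stands for \<open>a + b e1 + c e2 + d e3\<close>.\<close>

datatype cl2 = Cl2 (coord0: real) (coord1: real) (coord2: real) (coord3: real)

lemma cl2_eq_iff:
  "x = y \<longleftrightarrow> coord0 x = coord0 y \<and> coord1 x = coord1 y \<and> coord2 x = coord2 y \<and> coord3 x = coord3 y"
  by (auto intro: cl2.expand)

instantiation cl2 :: real_algebra_1
begin

definition "0 = Cl2 0 0 0 0"
definition "1 = Cl2 1 0 0 0"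
definition "x + y = Cl2 (coord0 x + coord0 y) (coord1 x + coord1 y) (coord2 x + coord2 y) (coord3 x + coord3 y)"
definition "- x = Cl2 (- coord0 x) (- coord1 x) (- coord2 x) (- coord3 x)"
definition "x - y = Cl2 (coord0 x - coord0 y) (coord1 x - coord1 y) (coord2 x - coord2 y) (coord3 x - coord3 y)"
definition "r *\<^sub>R x = Cl2 (r * coord0 x) (r * coord1 x) (r * coord2 x) (r * coord3 x)"

text \<open>The bilinear extension of the multiplication table of the basis, which is recovered in
  \<open>cl2_basis_mult\<close> below.\<close>

definition "x * y = Cl2
  (coord0 x * coord0 y + coord1 x * coord1 y + coord2 x * coord2 y - coord3 x * coord3 y)
  (coord0 x * coord1 y + coord1 x * coord0 y - coord2 x * coord3 y + coord3 x * coord2 y)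
  (coord0 x * coord2 y + coord2 x * coord0 y + coord1 x * coord3 y - coord3 x * coord1 y)
  (coord0 x * coord3 y + coord3 x * coord0 y + coord1 x * coord2 y - coord2 x * coord1 y)"

instance
  by standard
    (simp_all add: zero_cl2_def one_cl2_def plus_cl2_def uminus_cl2_def minus_cl2_def
      scaleR_cl2_def times_cl2_def cl2_eq_iff algebra_simps)

end

definition e1 :: cl2 where "e1 = Cl2 0 1 0 0"
definition e2 :: cl2 where "e2 = Cl2 0 0 1 0"
definition e3 :: cl2 where "e3 = Cl2 0 0 0 1"

lemma cl2_basis_expansion: "Cl2 a b c d = a *\<^sub>R 1 + b *\<^sub>R e1 + c *\<^sub>R e2 + d *\<^sub>R e3"
  by (simp add: e1_def e2_def e3_def one_cl2_def plus_cl2_def scaleR_cl2_def)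

lemma cl2_basis_mult:
  "e1 * e1 = 1" "e2 * e2 = 1" "e3 * e3 = - 1"
  "e1 * e2 = e3" "e2 * e1 = - e3"
  "e2 * e3 = - e1" "e3 * e2 = e1"
  "e3 * e1 = - e2" "e1 * e3 = e2"
  by (simp_all add: e1_def e2_def e3_def one_cl2_def uminus_cl2_def times_cl2_def)

text \<open>All norms on a finite-dimensional real vector space induce the same topology. The
  \<open>l1\<close> norm of the coordinates is submultiplicative with \<open>norm 1 = 1\<close>, because products of
  basis elements are basis elements up to sign; it therefore makes the library's \<open>exp\<close>, defined by
  the power series, available.\<close>

instantiation cl2 :: real_normed_algebra_1
begin

definition "norm x = \<bar>coord0 x\<bar> + \<bar>coord1 x\<bar> + \<bar>coord2 x\<bar> + \<bar>coord3 x\<bar>"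
definition "sgn x = x /\<^sub>R norm x" for x :: cl2
definition "dist x y = norm (x - y)" for x y :: cl2
definition [code del]:
  "(uniformity :: (cl2 \<times> cl2) filter) = (INF e\<in>{0 <..}. principal {(x, y). dist x y < e})"
definition [code del]:
  "open (U :: cl2 set) \<longleftrightarrow> (\<forall>x\<in>U. eventually (\<lambda>(x', y). x' = x \<longrightarrow> y \<in> U) uniformity)"

instance
proof
  fix x y :: cl2 and r :: real and U :: "cl2 set"
  show "dist x y = norm (x - y)" by (rule dist_cl2_def)
  show "sgn x = x /\<^sub>R norm x" by (rule sgn_cl2_def)
  show "(uniformity :: (cl2 \<times> cl2) filter) = (INF e\<in>{0 <..}. principal {(x, y). dist x y < e})"
    by (rule uniformity_cl2_def)
  show "open U \<longleftrightarrow> (\<forall>x\<in>U. eventually (\<lambda>(x', y). x' = x \<longrightarrow> y \<in> U) uniformity)"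
    by (rule open_cl2_def)
  show "norm x = 0 \<longleftrightarrow> x = 0"
    by (auto simp: norm_cl2_def zero_cl2_def cl2_eq_iff)
  show "norm (x + y) \<le> norm x + norm y"
  proof -
    have "norm (x + y) \<le> (\<bar>coord0 x\<bar> + \<bar>coord0 y\<bar>) + (\<bar>coord1 x\<bar> + \<bar>coord1 y\<bar>) +
        (\<bar>coord2 x\<bar> + \<bar>coord2 y\<bar>) + (\<bar>coord3 x\<bar> + \<bar>coord3 y\<bar>)"
      unfolding norm_cl2_def plus_cl2_def cl2.sel by (intro add_mono abs_triangle_ineq)
    then show ?thesis by (simp add: norm_cl2_def)
  qed
  show "norm (r *\<^sub>R x) = \<bar>r\<bar> * norm x"
    by (simp add: norm_cl2_def scaleR_cl2_def abs_mult algebra_simps)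
  show "norm (1 :: cl2) = 1"
    by (simp add: norm_cl2_def one_cl2_def)
  have tri: "\<bar>p + q + s - t\<bar> \<le> \<bar>p\<bar> + \<bar>q\<bar> + \<bar>s\<bar> + \<bar>t\<bar>"
            "\<bar>p + q - s + t\<bar> \<le> \<bar>p\<bar> + \<bar>q\<bar> + \<bar>s\<bar> + \<bar>t\<bar>" for p q s t :: real
    by linarith+
  let ?a = "\<lambda>f g. \<bar>f x\<bar> * \<bar>g y\<bar> :: real"
  have "norm (x * y) \<le>
      (?a coord0 coord0 + ?a coord1 coord1 + ?a coord2 coord2 + ?a coord3 coord3) +
      (?a coord0 coord1 + ?a coord1 coord0 + ?a coord2 coord3 + ?a coord3 coord2) +
      (?a coord0 coord2 + ?a coord2 coord0 + ?a coord1 coord3 + ?a coord3 coord1) +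
      (?a coord0 coord3 + ?a coord3 coord0 + ?a coord1 coord2 + ?a coord2 coord1)"
    unfolding norm_cl2_def times_cl2_def cl2.sel abs_mult[symmetric]
    by (intro add_mono tri)
  also have "\<dots> = norm x * norm y"
    by (simp add: norm_cl2_def algebra_simps)
  finally show "norm (x * y) \<le> norm x * norm y" .
qed

end

instance cl2 :: banach
proof
  fix X :: "nat \<Rightarrow> cl2"
  assume X: "Cauchy X"
  have *: "convergent (\<lambda>n. f (X n))"
    if f: "\<And>x y. \<bar>f x - f y\<bar> \<le> norm (x - y)" for f :: "cl2 \<Rightarrow> real"
  proof -
    have "Cauchy (\<lambda>n. f (X n))"
    proof (rule metric_CauchyI)
      fix e :: real assume "0 < e"
      then obtain M where "\<forall>m\<ge>M. \<forall>n\<ge>M. dist (X m) (X n) < e"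
        using X metric_CauchyD by blast
      then show "\<exists>M. \<forall>m\<ge>M. \<forall>n\<ge>M. dist (f (X m)) (f (X n)) < e"
        using f unfolding dist_norm real_norm_def by (meson le_less_trans)
    qed
    then show ?thesis by (simp add: Cauchy_convergent_iff)
  qed
  obtain a b c d where lim:
    "(\<lambda>n. coord0 (X n)) \<longlonglongrightarrow> a" "(\<lambda>n. coord1 (X n)) \<longlonglongrightarrow> b"
    "(\<lambda>n. coord2 (X n)) \<longlonglongrightarrow> c" "(\<lambda>n. coord3 (X n)) \<longlonglongrightarrow> d"
    using *[of coord0] *[of coord1] *[of coord2] *[of coord3]
    by (auto simp: convergent_def norm_cl2_def minus_cl2_def)
  have "(\<lambda>n. \<bar>coord0 (X n) - a\<bar> + \<bar>coord1 (X n) - b\<bar> + \<bar>coord2 (X n) - c\<bar> + \<bar>coord3 (X n) - d\<bar>)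
      \<longlonglongrightarrow> \<bar>a - a\<bar> + \<bar>b - b\<bar> + \<bar>c - c\<bar> + \<bar>d - d\<bar>"
    by (intro tendsto_intros lim)
  then have "(\<lambda>n. norm (X n - Cl2 a b c d)) \<longlonglongrightarrow> 0"
    by (simp add: norm_cl2_def minus_cl2_def)
  then have "X \<longlonglongrightarrow> Cl2 a b c d"
    by (simp add: tendsto_norm_zero_iff LIM_zero_iff)
  then show "convergent X" by (rule convergentI)
qed

lemma cl2_exp_sums: "(\<lambda>k. a ^ k /\<^sub>R fact k) sums exp a" for a :: cl2
  by (rule exp_converges)

definition E :: "real \<Rightarrow> cl2 set" where
  "E c = {\<epsilon>1 *\<^sub>R e1 + \<epsilon>2 *\<^sub>R e2 + \<epsilon>3 *\<^sub>R e3 | \<epsilon>1 \<epsilon>2 \<epsilon>3. \<epsilon>1\<^sup>2 + \<epsilon>2\<^sup>2 - \<epsilon>3\<^sup>2 = c}"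

end

theory Submission
  imports Defs
begin

text \<open>The square of an element of \<open>E c\<close> is the scalar \<open>c\<close>, so grouping the terms of index \<open>2k\<close> and
  \<open>2k + 1\<close> in the exponential series splits it into a scalar series and \<open>\<epsilon>\<close> times a scalar series.\<close>

lemma E_square:
  assumes "\<epsilon> \<in> E c"
  shows "\<epsilon> * \<epsilon> = of_real c"
  \<comment> \<open>Distinct basis vectors among \<open>e1\<close>, \<open>e2\<close>,
    \<open>e3\<close> anticommute, so the mixed products cancel in pairs and only the three squares,
    with signs +, +, -, remain.\<close>
  using assms
  by (auto simp: E_def e1_def e2_def e3_def plus_cl2_def scaleR_cl2_def times_cl2_def
      of_real_def one_cl2_def cl2_eq_iff power2_eq_square algebra_simps)

text \<open>Serves all three cases at once, with \<open>s\<close> equal to 1, -1 or 0. Only the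
  scalar square of \<open>u\<close> matters, so the algebra is arbitrary; the limits
  \<open>p\<close> and \<open>q\<close> are parameters, to be filled in by the closed forms.\<close>

lemma exp_square_scalar:
  fixes u :: "'a :: {real_normed_algebra_1, banach}" and s t p q :: real
  assumes square: "u * u = of_real s"
    and even: "(\<lambda>k. s ^ k * t ^ (2 * k) / fact (2 * k)) sums p"
    and odd: "(\<lambda>k. s ^ k * t ^ (2 * k + 1) / fact (2 * k + 1)) sums q"
  shows "exp (u * of_real t) = of_real p + u * of_real q"
proof -
  let ?f = "\<lambda>k. (u * of_real t) ^ k /\<^sub>R fact k"
  \<comment> \<open>The algebra may be noncommutative, but \<open>of_real t\<close> is a real
    multiple of 1 and hence central.\<close>
  have "u * of_real t * (u * of_real t) = u * u * of_real t * of_real t"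
    by (metis Real_Vector_Spaces.of_real_def mult.assoc mult_scaleR_left mult_scaleR_right mult_1_left mult_1_right)
  then have sq: "(u * of_real t)\<^sup>2 = of_real (s * t\<^sup>2)"
    by (simp add: square power2_eq_square mult.assoc)
  have pow: "(u * of_real t) ^ (2 * k) = of_real (s ^ k * t ^ (2 * k))" for k
    by (simp only: power_mult sq of_real_power[symmetric] power_mult_distrib)
  have f_even: "?f (2 * k) = of_real (s ^ k * t ^ (2 * k) / fact (2 * k))" for k
    unfolding pow by (simp add: of_real_def divide_inverse mult.commute)
  have f_odd: "?f (2 * k + 1) = u * of_real (s ^ k * t ^ (2 * k + 1) / fact (2 * k + 1))" for k
    unfolding power_add pow power_one_right
    by (simp add: of_real_def divide_inverse mult_ac)
  \<comment> \<open>The interval is the \<open>k\<close>-th block of length 2 in the form used by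
    \<open>sums_group\<close>. Bracketing consecutive terms of a convergent series keeps its
    sum.\<close>
  have "sum ?f {k * 2..<k * 2 + 2} = ?f (2 * k) + ?f (2 * k + 1)" for k
    by (simp add: numeral_2_eq_2 mult.commute)
  then have "(\<lambda>k. ?f (2 * k) + ?f (2 * k + 1)) sums exp (u * of_real t)"
    using sums_group[OF exp_converges[of "u * of_real t"], of 2] by simp
  moreover have "(\<lambda>k. ?f (2 * k) + ?f (2 * k + 1)) sums (of_real p + u * of_real q)"
    unfolding f_even f_odd by (intro sums_add sums_mult sums_of_real even odd)
  ultimately show ?thesis by (rule sums_unique2)
qed

text \<open>The series from \<open>cosh_converges\<close> runs over all indices with zeros at the
  odd ones; reindexing along the strictly increasing map from k to 2k drops only these zeros.
  \<open>sinh_paired\<close> does the same along the odd indices.\<close>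

lemma cosh_paired: "(\<lambda>k. x ^ (2 * k) / fact (2 * k)) sums cosh x" for x :: real
proof -
  let ?f = "\<lambda>n. if even n then x ^ n /\<^sub>R fact n else 0"
  have "(\<lambda>k. ?f (2 * k)) sums cosh x"
    using cosh_converges[of x]
    by (subst sums_mono_reindex) (auto simp: strict_mono_def elim!: evenE)
  then show ?thesis by (simp add: divide_inverse mult.commute)
qed

lemma sinh_paired: "(\<lambda>k. x ^ (2 * k + 1) / fact (2 * k + 1)) sums sinh x" for x :: real
proof -
  let ?f = "\<lambda>n. if even n then 0 else x ^ n /\<^sub>R fact n"
  have "(\<lambda>k. ?f (2 * k + 1)) sums sinh x"
    using sinh_converges[of x]
    by (subst sums_mono_reindex) (auto simp: strict_mono_def elim!: oddE)
  then show ?thesis by (simp add: divide_inverse mult_ac)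
qed

theorem theorem2p1:
  fixes \<theta> :: real and \<epsilon> :: cl2
  shows
    "(\<epsilon> \<in> E 1 \<longrightarrow>
       summable (\<lambda>k. \<theta> ^ (2 * k) / fact (2 * k)) \<and>
       summable (\<lambda>k. \<theta> ^ (2 * k + 1) / fact (2 * k + 1)) \<and>
       exp (\<epsilon> * of_real \<theta>) =
         of_real (\<Sum>k. \<theta> ^ (2 * k) / fact (2 * k)) +
         \<epsilon> * of_real (\<Sum>k. \<theta> ^ (2 * k + 1) / fact (2 * k + 1)) \<and>
       of_real (\<Sum>k. \<theta> ^ (2 * k) / fact (2 * k)) +
         \<epsilon> * of_real (\<Sum>k. \<theta> ^ (2 * k + 1) / fact (2 * k + 1)) =
         of_real (cosh \<theta>) + \<epsilon> * of_real (sinh \<theta>)) \<and>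
     (\<epsilon> \<in> E (- 1) \<longrightarrow>
       summable (\<lambda>k. (- 1) ^ k * \<theta> ^ (2 * k) / fact (2 * k)) \<and>
       summable (\<lambda>k. (- 1) ^ k * \<theta> ^ (2 * k + 1) / fact (2 * k + 1)) \<and>
       exp (\<epsilon> * of_real \<theta>) =
         of_real (\<Sum>k. (- 1) ^ k * \<theta> ^ (2 * k) / fact (2 * k)) +
         \<epsilon> * of_real (\<Sum>k. (- 1) ^ k * \<theta> ^ (2 * k + 1) / fact (2 * k + 1)) \<and>
       of_real (\<Sum>k. (- 1) ^ k * \<theta> ^ (2 * k) / fact (2 * k)) +
         \<epsilon> * of_real (\<Sum>k. (- 1) ^ k * \<theta> ^ (2 * k + 1) / fact (2 * k + 1)) =
         of_real (cos \<theta>) + \<epsilon> * of_real (sin \<theta>)) \<and>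
     (\<epsilon> \<in> E 0 \<longrightarrow> exp (\<epsilon> * of_real \<theta>) = 1 + \<epsilon> * of_real \<theta>)"
proof (intro conjI impI)
  note hyp = cosh_paired[of \<theta>] sinh_paired[of \<theta>]
  have trig: "(\<lambda>k. (- 1) ^ k * \<theta> ^ (2 * k) / fact (2 * k)) sums cos \<theta>"
    "(\<lambda>k. (- 1) ^ k * \<theta> ^ (2 * k + 1) / fact (2 * k + 1)) sums sin \<theta>"
    using cos_paired[of \<theta>] sin_paired[of \<theta>] by simp_all
  note hyp_suminf = hyp[THEN sums_unique, symmetric]
    and trig_suminf = trig[THEN sums_unique, symmetric]
  show "summable (\<lambda>k. \<theta> ^ (2 * k) / fact (2 * k))"
    "summable (\<lambda>k. \<theta> ^ (2 * k + 1) / fact (2 * k + 1))"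
    using hyp by (blast intro: sums_summable)+
  show "summable (\<lambda>k. (- 1) ^ k * \<theta> ^ (2 * k) / fact (2 * k))"
    "summable (\<lambda>k. (- 1) ^ k * \<theta> ^ (2 * k + 1) / fact (2 * k + 1))"
    using trig by (blast intro: sums_summable)+
  show "of_real (\<Sum>k. \<theta> ^ (2 * k) / fact (2 * k)) +
      \<epsilon> * of_real (\<Sum>k. \<theta> ^ (2 * k + 1) / fact (2 * k + 1)) =
      of_real (cosh \<theta>) + \<epsilon> * of_real (sinh \<theta>)"
    unfolding hyp_suminf ..
  show "of_real (\<Sum>k. (- 1) ^ k * \<theta> ^ (2 * k) / fact (2 * k)) +
      \<epsilon> * of_real (\<Sum>k. (- 1) ^ k * \<theta> ^ (2 * k + 1) / fact (2 * k + 1)) =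
      of_real (cos \<theta>) + \<epsilon> * of_real (sin \<theta>)"
    unfolding trig_suminf ..
  show "exp (\<epsilon> * of_real \<theta>) = of_real (\<Sum>k. \<theta> ^ (2 * k) / fact (2 * k)) +
      \<epsilon> * of_real (\<Sum>k. \<theta> ^ (2 * k + 1) / fact (2 * k + 1))" if "\<epsilon> \<in> E 1"
    \<comment> \<open>Here \<open>s\<close> is 1, and simplification removes the factor
      \<open>1 ^ k\<close>.\<close>
    unfolding hyp_suminf using hyp by (intro exp_square_scalar[OF E_square[OF that]]) simp_all
  show "exp (\<epsilon> * of_real \<theta>) = of_real (\<Sum>k. (- 1) ^ k * \<theta> ^ (2 * k) / fact (2 * k)) +
      \<epsilon> * of_real (\<Sum>k. (- 1) ^ k * \<theta> ^ (2 * k + 1) / fact (2 * k + 1))" if "\<epsilon> \<in> E (- 1)"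
    \<comment> \<open>With \<open>s\<close> equal to -1, the factor \<open>s ^ k\<close> is exactly
      the alternating sign of the series in \<open>trig\<close>.\<close>
    unfolding trig_suminf by (intro exp_square_scalar[OF E_square[OF that]] trig)
  show "exp (\<epsilon> * of_real \<theta>) = 1 + \<epsilon> * of_real \<theta>" if "\<epsilon> \<in> E 0"
  proof -
    \<comment> \<open>Since \<open>0 ^ 0 = 1\<close> and all higher powers of 0 vanish, only the
      term at k = 0 survives in each series.\<close>
    have "(\<lambda>k. 0 ^ k * \<theta> ^ (2 * k) / fact (2 * k)) sums 1"
      "(\<lambda>k. 0 ^ k * \<theta> ^ (2 * k + 1) / fact (2 * k + 1)) sums \<theta>"
      using sums_finite[of "{0}" "\<lambda>k. 0 ^ k * \<theta> ^ (2 * k) / fact (2 * k)"]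
        sums_finite[of "{0}" "\<lambda>k. 0 ^ k * \<theta> ^ (2 * k + 1) / fact (2 * k + 1)"]
      by simp_all
    from exp_square_scalar[OF E_square[OF that] this] show ?thesis by simp
  qed
qed

end
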